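(* Let $X\subseteq\mathbb{R}^{p}$, $Y\subseteq\mathbb{R}^{m}$ be closed convex sets, $W=X\times Y$, $A\in\mathbb{R}^{m\times p}$, and $f(x,y)=y^TAx+G(x)-F^*(y)$ on $W$, where $G:X\to\mathbb{R}$ is continuous and convex, and $F^*:Y\to\mathbb{R}$ is continuous and convex and is the convex conjugate of a continuous convex function $F$. Distances are Euclidean. Let $L=\|A\|_2$ (spectral norm), $\theta\in(0,L]$, $\gamma\in(0,1/L)$, $\beta\in(0,1)$, $\epsilon\in(0,1)$. Let $W^*$ (nonempty) be the optimal set defined in the context and suppose that for all $w\in W$, with $r^*=\|W^*-w\|$, one has $\theta(r^* )^2\le\Delta_{r^*}(w)$. Define $$q:=(1-\gamma^2L^2)^{-1/2},\qquad t^*:=\frac{(1+q)^2(1+\beta)^2}{\beta^2}\,\frac{1}{2\gamma\theta}+2 .$$ Let $\{v_i\}_{i\ge0}$, $\{\tau_i\}_{i\ge1}$ be generated by adaptively restarted PDHG (defined in the context) with step size $\gamma$ and parameter $\beta$, from $v_0\in W$ and with arbitrary initial epoch length $\tau_1\in\mathbb{N}$. Then for $$n=\left\lceil\log_{1/\beta}\!\left(\frac{1+q}{\epsilon}\max\left\{1,\frac{t^*}{\tau_1}\right\}\right)\right\rceil$$ one has $\|W^*-v_n\|\le\epsilon\,\|W^*-v_0\|$ and $\sum_{i=1}^n\tau_i\le t^*n+2(\tau_1-t^* )^+$.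
   Context: $\mathbb{N}=\{1,2,\dots\}$; $(a)^+=\max\{a,0\}$; $\|\cdot\|$ is the Euclidean norm; $w=(w_x,w_y)\in W$; $B_r(w)=\{\hat w\in W:\|w-\hat w\|\le r\}$; $\|\hat W-w\|=\inf_{\hat w\in\hat W}\|\hat w-w\|$. The localized duality gap is $\Delta_r(w)=\sup_{(x,y)\in B_r(w)} f(w_x,y)-f(x,w_y)$ and $W^*=\{w\in W:\Delta_r(w)=0\ \forall r>0\}$. PDHG (primal-dual hybrid gradient) from $v\in W$ with step size $\gamma$: set $u^0=v$, $\hat x^0=v_x$, and for $t=1,2,\dots$ $$u^t_y=\arg\min_{y\in Y}F^*(y)-y^TA\hat x^{t-1}+\tfrac1{2\gamma}\|y-u^{t-1}_y\|^2,$$ $$u^t_x=\arg\min_{x\in X}G(x)+(u^t_y)^TAx+\tfrac1{2\gamma}\|x-u^{t-1}_x\|^2,\qquad \hat x^t=2u^t_x-u^{t-1}_x .$$ The output at step $t$ is the running average $w^t(v)=\frac1t\sum_{k=1}^tu^k$. Adaptively restarted PDHG with parameter $\beta$: given $v_0\in W$, for epochs $i=1,2,\dots$ run PDHG from $v_{i-1}$, producing $w_i^t=w^t(v_{i-1})$. Epoch $1$ is stopped after an arbitrarily chosen number $\tau_1\in\mathbb{N}$ of steps. For $i>1$, epoch $i$ is stopped at the first $t\in\mathbb{N}$ (called $\tau_i$) with $$\frac{\|w_i^t-v_{i-1}\|}{t}\le\beta\,\frac{\|v_{i-1}-v_{i-2}\|}{\tau_{i-1}}.$$ Set $v_i=w_i^{\tau_i}$.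 *)

theory Defs
  imports "HOL-Analysis.Analysis"
begin

text \<open>Vectors \<open>w = (w\<^sub>x, w\<^sub>y)\<close> are pairs; the norm of the product type is the Euclidean one,
  \<open>norm (x, y) = sqrt ((norm x)\<^sup>2 + (norm y)\<^sup>2)\<close>. Functions on a subset are total
  functions of which only the values on that subset are used.\<close>

definition convex_conjugate ::
    "'a::euclidean_space set \<Rightarrow> ('a \<Rightarrow> real) \<Rightarrow> 'a \<Rightarrow> ereal" where
  \<comment> \<open>\<open>D\<close> is the effective domain of \<open>F\<close>, i.e. \<open>F = \<infinity>\<close> outside \<open>D\<close>.\<close>
  "convex_conjugate D F y = (SUP z\<in>D. ereal (y \<bullet> z - F z))"

definition spectral_norm :: "real ^ 'p ^ 'm \<Rightarrow> real" where
  "spectral_norm A = onorm (\<lambda>x. A *v x)"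

definition saddle_function ::
    "real ^ 'p ^ 'm \<Rightarrow> (real ^ 'p \<Rightarrow> real) \<Rightarrow> (real ^ 'm \<Rightarrow> real) \<Rightarrow> real ^ 'p \<Rightarrow> real ^ 'm \<Rightarrow> real" where
  "saddle_function A G Fs x y = y \<bullet> (A *v x) + G x - Fs y"

definition localized_duality_gap ::
    "('a::euclidean_space \<times> 'b::euclidean_space) set \<Rightarrow> ('a \<Rightarrow> 'b \<Rightarrow> real) \<Rightarrow> real \<Rightarrow> 'a \<times> 'b \<Rightarrow> real" where
  \<comment> \<open>For \<open>w \<in> W\<close> with \<open>W\<close> closed, \<open>r \<ge> 0\<close> and \<open>f\<close> continuous on \<open>W\<close>, the supremum is over a
    nonempty compact set, so the real-valued supremum is the intended one.\<close>
  "localized_duality_gap W f r w =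
     (SUP u\<in>W \<inter> cball w r. f (fst w) (snd u) - f (fst u) (snd w))"

definition optimal_set ::
    "('a::euclidean_space \<times> 'b::euclidean_space) set \<Rightarrow> ('a \<Rightarrow> 'b \<Rightarrow> real) \<Rightarrow> ('a \<times> 'b) set" where
  "optimal_set W f = {w \<in> W. \<forall>r>0. localized_duality_gap W f r w = 0}"

text \<open>The state after \<open>t\<close> steps consists of the iterate and the extrapolated primal point.
  On a nonempty closed convex set the functions being minimised are continuous and strongly
  convex, so \<open>arg_min_on\<close> denotes the unique minimiser.\<close>

primrec pdhg_state ::
    "(real ^ 'p) set \<Rightarrow> (real ^ 'm) set \<Rightarrow> real ^ 'p ^ 'm \<Rightarrow> (real ^ 'p \<Rightarrow> real) \<Rightarrow> (real ^ 'm \<Rightarrow> real)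
      \<Rightarrow> real \<Rightarrow> (real ^ 'p) \<times> (real ^ 'm) \<Rightarrow> nat \<Rightarrow> ((real ^ 'p) \<times> (real ^ 'm)) \<times> (real ^ 'p)" where
  "pdhg_state X Y A G Fs \<gamma> v 0 = (v, fst v)"
| "pdhg_state X Y A G Fs \<gamma> v (Suc t) =
    (let ((ux, uy), xh) = pdhg_state X Y A G Fs \<gamma> v t;
         uy' = arg_min_on (\<lambda>y. Fs y - y \<bullet> (A *v xh) + 1 / (2 * \<gamma>) * (norm (y - uy))\<^sup>2) Y;
         ux' = arg_min_on (\<lambda>x. G x + uy' \<bullet> (A *v x) + 1 / (2 * \<gamma>) * (norm (x - ux))\<^sup>2) X
     in ((ux', uy'), 2 *\<^sub>R ux' - ux))"

definition pdhg_iterate ::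
    "(real ^ 'p) set \<Rightarrow> (real ^ 'm) set \<Rightarrow> real ^ 'p ^ 'm \<Rightarrow> (real ^ 'p \<Rightarrow> real) \<Rightarrow> (real ^ 'm \<Rightarrow> real)
      \<Rightarrow> real \<Rightarrow> (real ^ 'p) \<times> (real ^ 'm) \<Rightarrow> nat \<Rightarrow> (real ^ 'p) \<times> (real ^ 'm)" where
  "pdhg_iterate X Y A G Fs \<gamma> v t = fst (pdhg_state X Y A G Fs \<gamma> v t)"

definition pdhg_average ::
    "(real ^ 'p) set \<Rightarrow> (real ^ 'm) set \<Rightarrow> real ^ 'p ^ 'm \<Rightarrow> (real ^ 'p \<Rightarrow> real) \<Rightarrow> (real ^ 'm \<Rightarrow> real)
      \<Rightarrow> real \<Rightarrow> (real ^ 'p) \<times> (real ^ 'm) \<Rightarrow> nat \<Rightarrow> (real ^ 'p) \<times> (real ^ 'm)" where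
  "pdhg_average X Y A G Fs \<gamma> v t = (1 / real t) *\<^sub>R (\<Sum>k=1..t. pdhg_iterate X Y A G Fs \<gamma> v k)"

definition restart_condition ::
    "(real ^ 'p) set \<Rightarrow> (real ^ 'm) set \<Rightarrow> real ^ 'p ^ 'm \<Rightarrow> (real ^ 'p \<Rightarrow> real) \<Rightarrow> (real ^ 'm \<Rightarrow> real)
      \<Rightarrow> real \<Rightarrow> real \<Rightarrow> (nat \<Rightarrow> (real ^ 'p) \<times> (real ^ 'm)) \<Rightarrow> (nat \<Rightarrow> nat) \<Rightarrow> nat \<Rightarrow> nat \<Rightarrow> bool" where
  "restart_condition X Y A G Fs \<gamma> \<beta> v \<tau> i t \<longleftrightarrow>
     norm (pdhg_average X Y A G Fs \<gamma> (v (i - 1)) t - v (i - 1)) / real t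
       \<le> \<beta> * (norm (v (i - 1) - v (i - 2)) / real (\<tau> (i - 1)))"

definition adaptively_restarted_pdhg ::
    "(real ^ 'p) set \<Rightarrow> (real ^ 'm) set \<Rightarrow> real ^ 'p ^ 'm \<Rightarrow> (real ^ 'p \<Rightarrow> real) \<Rightarrow> (real ^ 'm \<Rightarrow> real)
      \<Rightarrow> real \<Rightarrow> real \<Rightarrow> (nat \<Rightarrow> (real ^ 'p) \<times> (real ^ 'm)) \<Rightarrow> (nat \<Rightarrow> nat) \<Rightarrow> bool" where
  \<comment> \<open>That the restart condition is eventually met is not part of this definition: if it never is,
    \<open>LEAST\<close> is merely an unspecified number. The value \<open>\<tau> 0\<close> is irrelevant.\<close>
  "adaptively_restarted_pdhg X Y A G Fs \<gamma> \<beta> v \<tau> \<longleftrightarrow>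
     v 0 \<in> X \<times> Y \<and> 1 \<le> \<tau> 1 \<and>
     (\<forall>i\<ge>1. v i = pdhg_average X Y A G Fs \<gamma> (v (i - 1)) (\<tau> i)) \<and>
     (\<forall>i>1. \<tau> i = (LEAST t. 1 \<le> t \<and> restart_condition X Y A G Fs \<gamma> \<beta> v \<tau> i t))"

end

theory Submission
  imports Defs
begin

text \<open>Telescoping the optimality inequalities of the proximal steps gives, for the average \<open>w\<close> of \<open>t\<close>
  steps from \<open>v\<close>, the gap bound \<open>\<parallel>u - v\<parallel>\<^sup>2 / (2\<gamma>t)\<close> against every \<open>u \<in> W\<close>, and \<open>\<parallel>w - v\<parallel> \<le> (1 + q) \<parallel>W\<^sup>* - v\<parallel>\<close>.
  As the gap is concave along rays from \<open>w\<close>, sharpness at radius \<open>r = \<parallel>W\<^sup>* - w\<parallel>\<close> passes to every smaller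
  radius \<open>\<alpha>\<close>: \<open>2\<gamma>\<theta>t\<alpha>r \<le> (\<alpha> + \<parallel>w - v\<parallel>)\<^sup>2\<close>. The choice \<open>\<alpha> = min r \<parallel>w - v\<parallel>\<close> bounds \<open>r\<close> by a multiple of
  \<open>\<parallel>w - v\<parallel> / t\<close>, even when the epoch is too short for the gap bound at radius \<open>r\<close> to be informative.
  Hence the next restart condition holds as soon as its epoch has length
  \<open>t\<^sup>* - 1 + (t - t\<^sup>*)\<^sup>+ / 2\<close>, so the excess of the epoch lengths over \<open>t\<^sup>*\<close> halves with each epoch, while
  \<open>\<parallel>v\<^sub>i - v\<^sub>i\<^sub>-\<^sub>1\<parallel> / \<tau>\<^sub>i\<close>, and with it the distance to \<open>W\<^sup>*\<close>, decays like \<open>\<beta>\<^sup>i\<close>.\<close>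

section \<open>Proximal steps\<close>

lemma norm_convex_combination_diff:
  fixes x y p :: "'a::real_inner"
  shows "(norm ((1 - t) *\<^sub>R x + t *\<^sub>R y - p))\<^sup>2
    = (1 - t) * (norm (x - p))\<^sup>2 + t * (norm (y - p))\<^sup>2 - t * (1 - t) * (norm (x - y))\<^sup>2"
proof -
  have 1: "(1 - t) *\<^sub>R x + t *\<^sub>R y - p = (1 - t) *\<^sub>R (x - p) + t *\<^sub>R (y - p)"
    by (simp add: algebra_simps)
  have 2: "x - y = (x - p) - (y - p)" by simp
  show ?thesis
    unfolding 1 2 power2_norm_eq_inner
    by (simp add: inner_commute[of "y - p" "x - p"] inner_add_left inner_add_right
        inner_diff_left[of "x - p"] inner_diff_right[of _ "x - p" "y - p"] algebra_simps)
qed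

text \<open>The quadratic obeys the convexity inequality with an exact defect
  (\<open>norm_convex_combination_diff\<close>), and convexity of \<open>g\<close> adds to
  it.\<close>

lemma strongly_convex_combination:
  fixes g :: "'a::real_inner \<Rightarrow> real"
  assumes "convex_on S g" "x \<in> S" "y \<in> S" "0 \<le> t" "t \<le> 1"
    and h: "\<And>x. h x = g x + c * (norm (x - p))\<^sup>2"
  shows "h ((1 - t) *\<^sub>R x + t *\<^sub>R y) \<le> (1 - t) * h x + t * h y - c * (t * (1 - t)) * (norm (x - y))\<^sup>2"
proof -
  have "g ((1 - t) *\<^sub>R x + t *\<^sub>R y) \<le> (1 - t) * g x + t * g y"
    using assms by (intro convex_onD)
  then show ?thesis
    unfolding h norm_convex_combination_diff by (simp add: algebra_simps)
qed

text \<open>\<open>S\<close> may be unbounded, so compactness is applied to balls about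
  \<open>x0\<close>. A distant point \<open>x\<close> cannot lie below \<open>x0\<close>: the gain
  from strong convexity would push the point at distance 1 towards \<open>x\<close> below the
  minimum \<open>h z1\<close> over the unit ball.\<close>

lemma strongly_convex_attains_min:
  fixes g :: "'a::euclidean_space \<Rightarrow> real"
  assumes "closed S" "S \<noteq> {}" "continuous_on S g" "convex_on S g" "0 < c"
    and h: "\<And>x. h x = g x + c * (norm (x - p))\<^sup>2"
  obtains z where "z \<in> S" "\<And>x. x \<in> S \<Longrightarrow> h z \<le> h x"
proof -
  have cS: "convex S" using assms(4) by (simp add: convex_on_def)
  obtain x0 where x0: "x0 \<in> S" using \<open>S \<noteq> {}\<close> by blast
  have cont: "continuous_on S h"
    unfolding h by (intro continuous_intros assms)
  have min_ball: "\<exists>z\<in>S \<inter> cball x0 R. \<forall>x\<in>S \<inter> cball x0 R. h z \<le> h x" if "0 \<le> R" for R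
  proof (rule continuous_attains_inf)
    show "compact (S \<inter> cball x0 R)" using \<open>closed S\<close> by (simp add: closed_Int_compact)
    show "S \<inter> cball x0 R \<noteq> {}" using x0 that by auto
    show "continuous_on (S \<inter> cball x0 R) h" using cont continuous_on_subset by blast
  qed
  obtain z1 where z1: "z1 \<in> S" "\<And>x. x \<in> S \<inter> cball x0 1 \<Longrightarrow> h z1 \<le> h x"
    using min_ball[of 1] by auto
  \<comment> \<open>Beyond radius \<open>\<rho>\<close> the strong convexity gain
    \<open>c * (R - 1)\<close> at distance 1 exceeds \<open>h x0 - h z1\<close>.\<close>
  define \<rho> where "\<rho> = 1 + (h x0 - h z1) / c"
  have \<rho>1: "1 \<le> \<rho>" using z1(2)[of x0] x0 \<open>0 < c\<close> by (simp add: \<rho>_def)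
  have far: "h x0 \<le> h x" if x: "x \<in> S" and R: "\<rho> < dist x0 x" for x
  proof -
    define R where "R = dist x0 x"
    have R1: "1 < R" using R \<rho>1 by (simp add: R_def)
    have R2: "h x0 - h z1 \<le> c * (R - 1)"
      using R \<open>0 < c\<close> by (simp add: R_def \<rho>_def field_simps)
    define z where "z = (1 - 1 / R) *\<^sub>R x0 + (1 / R) *\<^sub>R x"
    have "z \<in> S" unfolding z_def using R1 x x0 cS by (intro convexD_alt) auto
    moreover have "dist x0 z = 1"
    proof -
      have "x0 - z = (1 / R) *\<^sub>R (x0 - x)" by (simp add: z_def algebra_simps)
      then have "dist x0 z = \<bar>1 / R\<bar> * R" unfolding dist_norm R_def by (metis dist_norm norm_scaleR)
      then show ?thesis using R1 by simp
    qed
    ultimately have "h z1 \<le> h z" by (intro z1) auto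
    also have "\<dots> \<le> (1 - 1 / R) * h x0 + (1 / R) * h x - c * (1 / R * (1 - 1 / R)) * R\<^sup>2"
      unfolding z_def R_def dist_norm
      by (rule strongly_convex_combination[OF assms(4) x0 x _ _ h])
        (use R1 in \<open>auto simp: R_def[symmetric] dist_norm[symmetric]\<close>)
    also have "\<dots> = h x0 + (h x - h x0) / R - c * (R - 1)"
      using R1 by (simp add: field_simps power2_eq_square)
    finally have "0 \<le> (h x - h x0) / R" using R2 by linarith
    then show ?thesis using R1 by (simp add: zero_le_divide_iff)
  qed
  obtain z where z: "z \<in> S" "\<And>x. x \<in> S \<inter> cball x0 \<rho> \<Longrightarrow> h z \<le> h x"
    using min_ball[of \<rho>] \<rho>1 by auto
  show thesis
  proof (rule that[OF z(1)])
    fix x assume "x \<in> S"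
    then show "h z \<le> h x"
      using z(2)[of x] z(2)[of x0] x0 far[of x] \<rho>1 by (cases "dist x0 x \<le> \<rho>") auto
  qed
qed

text \<open>The growth bound is the three-point inequality of a proximal step. Moving a fraction
  \<open>t\<close> from the minimiser towards \<open>x\<close> cannot decrease \<open>h\<close>;
  dividing the strong convexity inequality by \<open>t\<close> and letting \<open>t\<close> tend to
  0 yields the full coefficient \<open>c\<close>.\<close>

lemma arg_min_on_strongly_convex:
  fixes g :: "'a::euclidean_space \<Rightarrow> real"
  assumes "closed S" "S \<noteq> {}" "continuous_on S g" "convex_on S g" "0 < c"
    and h: "\<And>x. h x = g x + c * (norm (x - p))\<^sup>2"
  shows "arg_min_on h S \<in> S"
    and "x \<in> S \<Longrightarrow> h (arg_min_on h S) + c * (norm (x - arg_min_on h S))\<^sup>2 \<le> h x"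
proof -
  define z where "z = arg_min_on h S"
  obtain z0 where "z0 \<in> S" "\<And>x. x \<in> S \<Longrightarrow> h z0 \<le> h x"
    using strongly_convex_attains_min[OF assms] by metis
  \<comment> \<open>\<open>arg_min_on\<close> is a Hilbert choice, so it is a minimiser once one
    exists.\<close>
  then have "is_arg_min h (\<lambda>x. x \<in> S) z0" by (simp add: is_arg_min_linorder)
  then have "is_arg_min h (\<lambda>x. x \<in> S) z"
    unfolding z_def arg_min_on_def arg_min_def by (rule someI)
  then have z: "z \<in> S" "\<And>x. x \<in> S \<Longrightarrow> h z \<le> h x" by (auto simp: is_arg_min_linorder)
  then show "arg_min_on h S \<in> S" by (simp add: z_def)
  assume x: "x \<in> S"
  have cS: "convex S" using assms(4) by (simp add: convex_on_def)
  have "h z + c * (1 - t) * (norm (x - z))\<^sup>2 \<le> h x" if t: "0 < t" "t < 1" for t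
  proof -
    have "h z \<le> h ((1 - t) *\<^sub>R z + t *\<^sub>R x)"
      using t z x cS by (intro z convexD_alt) auto
    also have "\<dots> \<le> (1 - t) * h z + t * h x - c * (t * (1 - t)) * (norm (z - x))\<^sup>2"
      by (rule strongly_convex_combination[OF assms(4) z(1) x _ _ h]) (use t in auto)
    finally have "t * (h z + c * (1 - t) * (norm (x - z))\<^sup>2) \<le> t * h x"
      by (simp add: algebra_simps norm_minus_commute)
    then show ?thesis using t by simp
  qed
  then have "\<forall>\<^sub>F t in at_right 0. h z + c * (1 - t) * (norm (x - z))\<^sup>2 \<le> h x"
    by (intro eventually_at_rightI[of 0 1]) auto
  moreover have "((\<lambda>t. h z + c * (1 - t) * (norm (x - z))\<^sup>2) \<longlongrightarrow> h z + c * (1 - 0) * (norm (x - z))\<^sup>2) (at_right 0)"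
    by (intro tendsto_intros)
  ultimately have "h z + c * (1 - 0) * (norm (x - z))\<^sup>2 \<le> h x"
    by (intro tendsto_upperbound[of _ _ "at_right 0"]) auto
  then show "h (arg_min_on h S) + c * (norm (x - arg_min_on h S))\<^sup>2 \<le> h x"
    by (simp add: z_def)
qed

section \<open>Linear terms, the spectral norm, and averages\<close>

lemma convex_on_linear: "convex S \<Longrightarrow> linear h \<Longrightarrow> convex_on S h" for h :: "'a::real_vector \<Rightarrow> real"
  by (rule convex_onI) (auto simp: linear_add linear_scale)

lemma inner_matrix_vector_le:
  fixes A :: "real ^ 'p ^ 'm"
  shows "y \<bullet> (A *v x) \<le> spectral_norm A * norm y * norm x"
proof -
  have "y \<bullet> (A *v x) \<le> norm y * norm (A *v x)" by (rule norm_cauchy_schwarz)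
  also have "\<dots> \<le> norm y * (spectral_norm A * norm x)"
    unfolding spectral_norm_def by (intro mult_left_mono onorm) auto
  finally show ?thesis by (simp add: ac_simps)
qed

lemma spectral_norm_nonneg: "0 \<le> spectral_norm A"
  unfolding spectral_norm_def by (intro onorm_pos_le) auto

lemma convex_on_average:
  fixes z :: "nat \<Rightarrow> 'a::real_vector"
  assumes "convex_on S g" "1 \<le> t" "\<And>k. z k \<in> S"
  shows "(1 / real t) *\<^sub>R (\<Sum>k=1..t. z k) \<in> S"
    and "g ((1 / real t) *\<^sub>R (\<Sum>k=1..t. z k)) \<le> (\<Sum>k=1..t. g (z k)) / real t"
proof -
  have cS: "convex S" using assms(1) by (simp add: convex_on_def)
  have eq: "(1 / real t) *\<^sub>R (\<Sum>k=1..t. z k) = (\<Sum>k=1..t. (1 / real t) *\<^sub>R z k)"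
    by (simp add: scaleR_sum_right)
  show "(1 / real t) *\<^sub>R (\<Sum>k=1..t. z k) \<in> S"
    unfolding eq using assms cS by (intro convex_sum) auto
  have "g (\<Sum>k=1..t. (1 / real t) *\<^sub>R z k) \<le> (\<Sum>k=1..t. (1 / real t) * g (z k))"
    using assms by (intro convex_on_sum) auto
  then show "g ((1 / real t) *\<^sub>R (\<Sum>k=1..t. z k)) \<le> (\<Sum>k=1..t. g (z k)) / real t"
    unfolding eq by (simp add: sum_divide_distrib)
qed

section \<open>Numerical inequalities\<close>

text \<open>Applied with \<open>z = sqrt (\<kappa> * t)\<close>. Up to \<open>C\<close>, the
  quotient \<open>z\<^sup>2 / (z - 1)\<close> increases for \<open>z > 2\<close>; beyond
  \<open>C\<close>, it grows only linearly and half of the square dominates it.\<close>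

lemma square_over_pred_le:
  fixes a C z :: real
  assumes "2 \<le> a" "a + 2 \<le> C" "2 < z"
  shows "a * z\<^sup>2 / (z - 1) \<le> C\<^sup>2 + max (z\<^sup>2 - C\<^sup>2) 0 / 2"
proof (cases "z \<le> C")
  case True
  have "(C - 1) * (z - 1) \<ge> 1 * 1" using assms by (intro mult_mono) auto
  \<comment> \<open>The product expands to
    \<open>C\<^sup>2 * (z - 1) - z\<^sup>2 * (C - 1)\<close>.\<close>
  then have "0 \<le> (C - z) * ((C - 1) * (z - 1) - 1)" using True by simp
  then have "z\<^sup>2 * (C - 1) \<le> C\<^sup>2 * (z - 1)" by (simp add: algebra_simps power2_eq_square)
  moreover have "z\<^sup>2 * a \<le> z\<^sup>2 * (C - 1)" using assms by (intro mult_left_mono) auto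
  ultimately have "a * z\<^sup>2 \<le> C\<^sup>2 * (z - 1)" by (simp add: mult.commute)
  then have "a * z\<^sup>2 / (z - 1) \<le> C\<^sup>2" using assms by (simp add: divide_le_eq)
  also have "\<dots> \<le> C\<^sup>2 + max (z\<^sup>2 - C\<^sup>2) 0 / 2" by simp
  finally show ?thesis .
next
  case False
  have "z\<^sup>2 \<le> (z + 2) * (z - 1)" using assms by (simp add: algebra_simps power2_eq_square)
  then have "a * z\<^sup>2 \<le> a * ((z + 2) * (z - 1))" using assms by (intro mult_left_mono) auto
  then have "a * z\<^sup>2 / (z - 1) \<le> a * (z + 2)" using assms by (simp add: divide_le_eq mult.assoc)
  also have "\<dots> \<le> (C\<^sup>2 + z\<^sup>2) / 2"
  proof -
    \<comment> \<open>The difference of the two sides is at least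
      \<open>((z - a)\<^sup>2 + 4) / 2\<close>.\<close>
    have "(a + 2)\<^sup>2 \<le> C\<^sup>2" using assms by (intro power_mono) auto
    moreover have "0 \<le> (z - a)\<^sup>2" by simp
    ultimately show ?thesis by (simp add: algebra_simps power2_eq_square)
  qed
  also have "\<dots> = C\<^sup>2 + (z\<^sup>2 - C\<^sup>2) / 2" by (simp add: field_simps)
  also have "\<dots> \<le> C\<^sup>2 + max (z\<^sup>2 - C\<^sup>2) 0 / 2" 
    by (intro add_left_mono divide_right_mono max.cobounded1) simp
  finally show ?thesis .
qed

text \<open>The hypothesis is what sharpness yields for an epoch of length \<open>t\<close> and displacement \<open>s\<close>
  whose endpoint has distance \<open>r\<close> from the optimal set; \<open>\<alpha>\<close> is the radius at which the localized
  gap is evaluated.\<close>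

lemma distance_le_rate:
  fixes \<kappa> a b t r s T :: real
  assumes "0 < \<kappa>" "2 \<le> a" "2 \<le> a * b" "4 \<le> a * (1 + b)\<^sup>2"
    and "0 < t" "0 \<le> r" "0 \<le> s"
    and T: "T = a\<^sup>2 * (1 + b)\<^sup>2 / \<kappa> + 2"
    and ineq: "\<And>\<alpha>. 0 < \<alpha> \<Longrightarrow> \<alpha> \<le> r \<Longrightarrow> \<alpha> * \<kappa> * t * r \<le> (\<alpha> + s)\<^sup>2"
  shows "a * r * t \<le> (T - 1 + max (t - T) 0 / 2) * s"
proof -
  define C where "C = a * (1 + b)"
  have C: "a + 2 \<le> C" using assms by (simp add: C_def algebra_simps)
  have T': "T = C\<^sup>2 / \<kappa> + 2" by (simp add: T C_def power_mult_distrib)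
  have aC: "4 * a \<le> C\<^sup>2"
  proof -
    have "a * 4 \<le> a * (a * (1 + b)\<^sup>2)" using assms by (intro mult_left_mono) auto
    then show ?thesis by (simp add: C_def power2_eq_square algebra_simps)
  qed
  have T1: "4 * a / \<kappa> \<le> T - 1"
  proof -
    have "4 * a / \<kappa> \<le> C\<^sup>2 / \<kappa>" using aC \<open>0 < \<kappa>\<close> by (intro divide_right_mono) auto
    then show ?thesis by (simp add: T')
  qed
  \<comment> \<open>Since \<open>4 * a \<le> C\<^sup>2\<close>, the resulting factor
    \<open>4 * a / \<kappa>\<close> fits below \<open>T - 1\<close>.\<close>
  have easy: ?thesis if "\<kappa> * t * r \<le> 4 * s"
  proof -
    have "a * (\<kappa> * t * r) \<le> a * (4 * s)" using that assms by (intro mult_left_mono) auto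
    then have "a * r * t \<le> 4 * a / \<kappa> * s" using \<open>0 < \<kappa>\<close> by (simp add: field_simps)
    also have "\<dots> \<le> (T - 1 + max (t - T) 0 / 2) * s"
      using T1 \<open>0 \<le> s\<close> by (intro mult_right_mono add_increasing2) auto
    finally show ?thesis .
  qed
  consider "r = 0" | "0 < r" "s = 0" | "0 < s" "s \<le> r" | "0 < r" "r < s"
    using \<open>0 \<le> r\<close> \<open>0 \<le> s\<close> by linarith
  then show ?thesis
  proof cases
    case 1
    then show ?thesis using easy \<open>0 \<le> s\<close> by simp
  next
    case 2
    \<comment> \<open>With \<open>s = 0\<close>, \<open>ineq\<close> fails for any positive
      \<open>\<alpha>\<close> below \<open>\<kappa> * t * r\<close>; the half makes this
      strict.\<close>
    define \<alpha> where "\<alpha> = min r (\<kappa> * t * r / 2)"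
    have pos: "0 < \<kappa> * t * r" using 2 assms by simp
    then have \<alpha>: "0 < \<alpha>" "\<alpha> \<le> r" "\<alpha> < \<kappa> * t * r" using 2 by (auto simp: \<alpha>_def)
    have "\<alpha> * (\<kappa> * t * r) \<le> \<alpha> * \<alpha>"
      using ineq[OF \<alpha>(1,2)] 2 by (simp add: power2_eq_square algebra_simps)
    then have "\<kappa> * t * r \<le> \<alpha>" using \<alpha>(1) by simp
    then show ?thesis using \<alpha>(3) by simp
  next
    case 3
    \<comment> \<open>The radius \<open>\<alpha> = s\<close> turns the right side of
      \<open>ineq\<close> into \<open>4 * s\<^sup>2\<close>.\<close>
    have "s * (\<kappa> * t * r) \<le> s * (4 * s)"
      using ineq[OF 3] by (simp add: power2_eq_square algebra_simps)
    then show ?thesis using 3 easy by simp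
  next
    case 4
    \<comment> \<open>The radius \<open>\<alpha> = r\<close> gives
      \<open>(z - 1) * r \<le> s\<close> after taking roots. This is weak for \<open>z\<close> near
      1, hence the split at 2.\<close>
    define z where "z = sqrt (\<kappa> * t)"
    have z2: "z\<^sup>2 = \<kappa> * t" and z0: "0 < z" using assms by (auto simp: z_def)
    have "(z * r)\<^sup>2 \<le> (r + s)\<^sup>2"
      using ineq[of r] 4 by (simp add: power_mult_distrib z2) (simp add: power2_eq_square algebra_simps)
    then have "z * r \<le> r + s" using 4 by (elim power2_le_imp_le) auto
    then have zr: "(z - 1) * r \<le> s" by (simp add: algebra_simps)
    show ?thesis
    proof (cases "z \<le> 2")
      case True
      have "z\<^sup>2 \<le> 2\<^sup>2" using True z0 by (intro power_mono) auto
      then have "\<kappa> * t * r \<le> 4 * r" using 4 by (intro mult_right_mono) (auto simp: z2)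
      then show ?thesis using easy 4 by linarith
    next
      case False
      have "r \<le> s / (z - 1)" using zr False by (simp add: le_divide_eq mult.commute)
      then have "(a * t) * r \<le> (a * t) * (s / (z - 1))"
        using assms by (intro mult_left_mono) auto
      then have "a * r * t \<le> a * t / (z - 1) * s" by (simp add: ac_simps)
      also have "\<dots> = (a * z\<^sup>2 / (z - 1)) / \<kappa> * s" using \<open>0 < \<kappa>\<close> by (simp add: z2)
      also have "\<dots> \<le> (C\<^sup>2 + max (z\<^sup>2 - C\<^sup>2) 0 / 2) / \<kappa> * s"
        using square_over_pred_le[of a C z] False C assms
        by (intro mult_right_mono divide_right_mono) auto
      also have "(C\<^sup>2 + max (z\<^sup>2 - C\<^sup>2) 0 / 2) / \<kappa> = C\<^sup>2 / \<kappa> + max (t - C\<^sup>2 / \<kappa>) 0 / 2"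
        using \<open>0 < \<kappa>\<close> by (auto simp: z2 max_def field_simps)
      \<comment> \<open>\<open>C\<^sup>2 / \<kappa>\<close> is \<open>T - 2\<close>. Replacing it by
        \<open>T\<close> inside the halved maximum costs at most 1; the other unit is kept for
        rounding up an epoch length.\<close>
      also have "(C\<^sup>2 / \<kappa> + max (t - C\<^sup>2 / \<kappa>) 0 / 2) * s \<le> (T - 1 + max (t - T) 0 / 2) * s"
        using \<open>0 \<le> s\<close> by (intro mult_right_mono) (auto simp: T')
      finally show ?thesis .
    qed
  qed
qed

section \<open>One epoch of PDHG\<close>

text \<open>The sign makes it convex in the last argument, where the iterates go. The localized
  duality gap at \<open>w\<close> is the supremum of \<open>saddle_gap A G Fs u w\<close>, its
  negative.\<close>

definition saddle_gap ::
    "real ^ 'p ^ 'm \<Rightarrow> (real ^ 'p \<Rightarrow> real) \<Rightarrow> (real ^ 'm \<Rightarrow> real)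
      \<Rightarrow> (real ^ 'p) \<times> (real ^ 'm) \<Rightarrow> (real ^ 'p) \<times> (real ^ 'm) \<Rightarrow> real" where
  "saddle_gap A G Fs w u = saddle_function A G Fs (fst u) (snd w) - saddle_function A G Fs (fst w) (snd u)"

lemma saddle_gap_self: "saddle_gap A G Fs w w = 0"
  by (simp add: saddle_gap_def)

lemma saddle_gap_swap: "saddle_gap A G Fs u w = - saddle_gap A G Fs w u"
  by (simp add: saddle_gap_def)

locale pdhg =
  fixes X :: "(real ^ 'p) set" and Y :: "(real ^ 'm) set" and A :: "real ^ 'p ^ 'm"
    and G :: "real ^ 'p \<Rightarrow> real" and Fs :: "real ^ 'm \<Rightarrow> real" and \<gamma> :: real
  assumes closed_X: "closed X" and closed_Y: "closed Y"
    and cont_G: "continuous_on X G" and conv_G: "convex_on X G"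
    and cont_Fs: "continuous_on Y Fs" and conv_Fs: "convex_on Y Fs"
    and \<gamma>_pos: "0 < \<gamma>" and \<gamma>_less: "\<gamma> * spectral_norm A < 1"
begin

section \<open>Convexity and continuity of the gap\<close>

lemma convex_X: "convex X" and convex_Y: "convex Y"
  using conv_G conv_Fs by (auto simp: convex_on_def)

abbreviation "iter v t \<equiv> pdhg_iterate X Y A G Fs \<gamma> v t"
abbreviation "avg v t \<equiv> pdhg_average X Y A G Fs \<gamma> v t"
abbreviation "gap \<equiv> saddle_gap A G Fs"

lemma convex_on_gap: "convex_on (X \<times> Y) (gap w)"
proof (rule convex_onI)
  fix t :: real and u u' :: "(real ^ 'p) \<times> (real ^ 'm)"
  assume t: "0 < t" "t < 1" and u: "u \<in> X \<times> Y" "u' \<in> X \<times> Y"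
  have "G ((1 - t) *\<^sub>R fst u + t *\<^sub>R fst u') \<le> (1 - t) * G (fst u) + t * G (fst u')"
    using t u by (intro convex_onD[OF conv_G]) auto
  moreover have "Fs ((1 - t) *\<^sub>R snd u + t *\<^sub>R snd u') \<le> (1 - t) * Fs (snd u) + t * Fs (snd u')"
    using t u by (intro convex_onD[OF conv_Fs]) auto
  ultimately show "gap w ((1 - t) *\<^sub>R u + t *\<^sub>R u') \<le> (1 - t) * gap w u + t * gap w u'"
    unfolding saddle_gap_def saddle_function_def
    by (simp add: matrix_vector_right_distrib matrix_vector_mult_scaleR inner_add_left inner_add_right algebra_simps)
next
  show "convex (X \<times> Y)" using convex_X convex_Y by (rule convex_Times)
qed

lemma continuous_on_gap: "continuous_on (X \<times> Y) (gap w)"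
proof -
  have "continuous_on (X \<times> Y) (\<lambda>u. G (fst u))"
    by (rule continuous_on_compose2[OF cont_G]) (auto intro: continuous_intros)
  moreover have "continuous_on (X \<times> Y) (\<lambda>u. Fs (snd u))"
    by (rule continuous_on_compose2[OF cont_Fs]) (auto intro: continuous_intros)
  moreover have "continuous_on (X \<times> Y) (\<lambda>u. A *v fst u)"
    by (rule bounded_linear.continuous_on[OF matrix_vector_mul_bounded_linear])
      (rule continuous_on_fst[OF continuous_on_id])
  ultimately show ?thesis
    unfolding saddle_gap_def saddle_function_def
    by (intro continuous_on_diff continuous_on_add continuous_on_inner continuous_on_const
        continuous_on_snd continuous_on_id)
qed

text \<open>The localized gap vanishes at a radius large enough to reach \<open>u\<close>;
  compactness makes the real supremum a genuine upper bound.\<close>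

lemma gap_optimal_nonneg:
  assumes w: "w \<in> optimal_set (X \<times> Y) (saddle_function A G Fs)" and u: "u \<in> X \<times> Y"
  shows "0 \<le> gap w u"
proof -
  define r where "r = dist w u + 1"
  have r: "0 < r" by (simp add: r_def add_nonneg_pos)
  have "compact ((X \<times> Y) \<inter> cball w r)"
    using closed_X closed_Y by (simp add: closed_Int_compact closed_Times)
  moreover have "continuous_on ((X \<times> Y) \<inter> cball w r) (\<lambda>u. - gap w u)"
    using continuous_on_gap[of w] by (intro continuous_intros) (auto intro: continuous_on_subset)
  ultimately have "bdd_above ((\<lambda>u. - gap w u) ` ((X \<times> Y) \<inter> cball w r))"
    by (intro bounded_imp_bdd_above compact_imp_bounded compact_continuous_image)
  then have "- gap w u \<le> (SUP u\<in>(X \<times> Y) \<inter> cball w r. - gap w u)"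
    using u by (intro cSUP_upper) (auto simp: r_def)
  also have "\<dots> = localized_duality_gap (X \<times> Y) (saddle_function A G Fs) r w"
    by (simp add: localized_duality_gap_def saddle_gap_def)
  also have "\<dots> = 0" using w r by (simp add: optimal_set_def)
  finally show ?thesis by simp
qed

section \<open>The recursion and its optimality conditions\<close>

lemma iter_0: "iter v 0 = v"
  by (simp add: pdhg_iterate_def)

text \<open>At \<open>t = 0\<close> truncated subtraction gives
  \<open>2 *\<^sub>R fst v - fst v = fst v\<close>, the prescribed initial extrapolation.\<close>

lemma snd_pdhg_state:
  "snd (pdhg_state X Y A G Fs \<gamma> v t) = 2 *\<^sub>R fst (iter v t) - fst (iter v (t - 1))"
proof (cases t)
  case 0
  then show ?thesis by (simp add: pdhg_iterate_def scaleR_2)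
next
  case (Suc k)
  obtain ux uy xh where "pdhg_state X Y A G Fs \<gamma> v k = ((ux, uy), xh)"
    by (metis surj_pair)
  then show ?thesis by (simp add: Suc pdhg_iterate_def Let_def)
qed

lemma iter_Suc:
  fixes v t
  defines "xh \<equiv> 2 *\<^sub>R fst (iter v t) - fst (iter v (t - 1))"
  shows "snd (iter v (Suc t)) = arg_min_on (\<lambda>y. Fs y - y \<bullet> (A *v xh) + 1 / (2 * \<gamma>) * (norm (y - snd (iter v t)))\<^sup>2) Y"
    and "fst (iter v (Suc t)) = arg_min_on (\<lambda>x. G x + snd (iter v (Suc t)) \<bullet> (A *v x)
        + 1 / (2 * \<gamma>) * (norm (x - fst (iter v t)))\<^sup>2) X"
proof -
  obtain ux uy where state: "pdhg_state X Y A G Fs \<gamma> v t = ((ux, uy), xh)"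
    using snd_pdhg_state[of v t] unfolding xh_def by (metis surj_pair snd_conv)
  then have u: "fst (iter v t) = ux" "snd (iter v t) = uy"
    by (simp_all add: pdhg_iterate_def)
  show "snd (iter v (Suc t)) = arg_min_on (\<lambda>y. Fs y - y \<bullet> (A *v xh) + 1 / (2 * \<gamma>) * (norm (y - snd (iter v t)))\<^sup>2) Y"
    and "fst (iter v (Suc t)) = arg_min_on (\<lambda>x. G x + snd (iter v (Suc t)) \<bullet> (A *v x)
        + 1 / (2 * \<gamma>) * (norm (x - fst (iter v t)))\<^sup>2) X"
    unfolding u by (simp_all add: pdhg_iterate_def state Let_def)
qed

text \<open>The bilinear term is linear in the variable being updated, so each half step is a
  proximal step with \<open>c = 1 / (2 * \<gamma>)\<close>. The dual step sees the extrapolated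
  \<open>xh\<close>, the primal step the new dual point.\<close>

lemma iter_Suc_optimality:
  fixes v t
  defines "xh \<equiv> 2 *\<^sub>R fst (iter v t) - fst (iter v (t - 1))"
  assumes "w \<in> X \<times> Y"
  shows "iter v (Suc t) \<in> X \<times> Y"
    and "Fs (snd (iter v (Suc t))) - snd (iter v (Suc t)) \<bullet> (A *v xh)
        + 1 / (2 * \<gamma>) * (norm (snd (iter v (Suc t)) - snd (iter v t)))\<^sup>2
        + 1 / (2 * \<gamma>) * (norm (snd w - snd (iter v (Suc t))))\<^sup>2
      \<le> Fs (snd w) - snd w \<bullet> (A *v xh) + 1 / (2 * \<gamma>) * (norm (snd w - snd (iter v t)))\<^sup>2"
    and "G (fst (iter v (Suc t))) + snd (iter v (Suc t)) \<bullet> (A *v fst (iter v (Suc t)))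
        + 1 / (2 * \<gamma>) * (norm (fst (iter v (Suc t)) - fst (iter v t)))\<^sup>2
        + 1 / (2 * \<gamma>) * (norm (fst w - fst (iter v (Suc t))))\<^sup>2
      \<le> G (fst w) + snd (iter v (Suc t)) \<bullet> (A *v fst w) + 1 / (2 * \<gamma>) * (norm (fst w - fst (iter v t)))\<^sup>2"
proof -
  have w: "fst w \<in> X" "snd w \<in> Y" using assms by auto
  have c: "0 < 1 / (2 * \<gamma>)" using \<gamma>_pos by simp
  have contY: "continuous_on Y (\<lambda>y. Fs y - y \<bullet> (A *v xh))"
    by (intro continuous_intros cont_Fs)
  have linY: "linear (\<lambda>y. - (y \<bullet> (A *v xh)))"
    by (rule linearI) (auto simp: inner_add_left)
  have convY: "convex_on Y (\<lambda>y. Fs y - y \<bullet> (A *v xh))"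
    using convex_on_add[OF conv_Fs convex_on_linear[OF convex_Y linY]] by simp
  let ?y = "snd (iter v (Suc t))"
  have contX: "continuous_on X (\<lambda>x. G x + ?y \<bullet> (A *v x))"
    by (intro continuous_intros cont_G bounded_linear.continuous_on[OF matrix_vector_mul_bounded_linear])
  have linX: "linear (\<lambda>x. ?y \<bullet> (A *v x))"
    by (rule linearI) (auto simp: matrix_vector_right_distrib matrix_vector_mult_scaleR inner_add_right)
  have convX: "convex_on X (\<lambda>x. G x + ?y \<bullet> (A *v x))"
    by (rule convex_on_add[OF conv_G convex_on_linear[OF convex_X linX]])
  note pY = arg_min_on_strongly_convex[OF closed_Y _ contY convY c refl, where p = "snd (iter v t)",
      folded iter_Suc(1)[of v t, folded xh_def]]
  note pX = arg_min_on_strongly_convex[OF closed_X _ contX convX c refl, where p = "fst (iter v t)",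
      folded iter_Suc(2)[of v t]]
  have "Y \<noteq> {}" "X \<noteq> {}" using w by auto
  then show "iter v (Suc t) \<in> X \<times> Y"
    using pY(1) pX(1) by (auto simp: mem_Times_iff)
  show "Fs ?y - ?y \<bullet> (A *v xh) + 1 / (2 * \<gamma>) * (norm (?y - snd (iter v t)))\<^sup>2
      + 1 / (2 * \<gamma>) * (norm (snd w - ?y))\<^sup>2
      \<le> Fs (snd w) - snd w \<bullet> (A *v xh) + 1 / (2 * \<gamma>) * (norm (snd w - snd (iter v t)))\<^sup>2"
    using pY(2)[OF _ w(2)] \<open>Y \<noteq> {}\<close> by simp
  show "G (fst (iter v (Suc t))) + ?y \<bullet> (A *v fst (iter v (Suc t)))
      + 1 / (2 * \<gamma>) * (norm (fst (iter v (Suc t)) - fst (iter v t)))\<^sup>2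
      + 1 / (2 * \<gamma>) * (norm (fst w - fst (iter v (Suc t))))\<^sup>2
      \<le> G (fst w) + ?y \<bullet> (A *v fst w) + 1 / (2 * \<gamma>) * (norm (fst w - fst (iter v t)))\<^sup>2"
    using pX(2)[OF _ w(1)] \<open>X \<noteq> {}\<close> by simp
qed

lemma iter_in: "v \<in> X \<times> Y \<Longrightarrow> iter v t \<in> X \<times> Y"
  using iter_Suc_optimality(1)[of v v] by (cases t) (auto simp: iter_0)

section \<open>Telescoping the gaps of the iterates\<close>

text \<open>Young's inequality, weighted so that the primal square has exactly the coefficient
  \<open>1 / (2 * \<gamma>)\<close> of the proximal terms.\<close>

lemma inner_matrix_vector_le_squares:
  "y \<bullet> (A *v x) \<le> ((\<gamma> * spectral_norm A)\<^sup>2 * (norm y)\<^sup>2 + (norm x)\<^sup>2) / (2 * \<gamma>)"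
proof -
  have "0 \<le> (\<gamma> * spectral_norm A * norm y - norm x)\<^sup>2" by simp
  then have "(spectral_norm A * norm y * norm x) * (2 * \<gamma>)
      \<le> (\<gamma> * spectral_norm A)\<^sup>2 * (norm y)\<^sup>2 + (norm x)\<^sup>2"
    unfolding power2_diff power_mult_distrib by (simp add: ac_simps)
  then have "spectral_norm A * norm y * norm x
      \<le> ((\<gamma> * spectral_norm A)\<^sup>2 * (norm y)\<^sup>2 + (norm x)\<^sup>2) / (2 * \<gamma>)"
    using \<gamma>_pos by (simp add: pos_le_divide_eq)
  then show ?thesis using inner_matrix_vector_le[of y A x] by linarith
qed

text \<open>Sum of the two proximal inequalities. The bilinear terms cancel except for the error of
  using \<open>xh\<close> instead of the new primal point, and that error is
  \<open>d (Suc t) - d t\<close>.\<close>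

lemma gap_iter_Suc_le:
  fixes v
  assumes w: "w \<in> X \<times> Y"
  defines "d \<equiv> \<lambda>t. fst (iter v t) - fst (iter v (t - 1))"
  shows "gap w (iter v (Suc t)) \<le> (snd w - snd (iter v (Suc t))) \<bullet> (A *v (d (Suc t) - d t))
    + ((norm (w - iter v t))\<^sup>2 - (norm (iter v (Suc t) - iter v t))\<^sup>2 - (norm (w - iter v (Suc t)))\<^sup>2) / (2 * \<gamma>)"
proof -
  let ?u = "iter v t" and ?u' = "iter v (Suc t)"
  define xh where "xh = 2 *\<^sub>R fst ?u - fst (iter v (t - 1))"
  have sq: "(norm (w - ?u))\<^sup>2 = (norm (fst w - fst ?u))\<^sup>2 + (norm (snd w - snd ?u))\<^sup>2"
    "(norm (?u' - ?u))\<^sup>2 = (norm (fst ?u' - fst ?u))\<^sup>2 + (norm (snd ?u' - snd ?u))\<^sup>2"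
    "(norm (w - ?u'))\<^sup>2 = (norm (fst w - fst ?u'))\<^sup>2 + (norm (snd w - snd ?u'))\<^sup>2"
    by (simp_all add: norm_prod_def)
  have "d (Suc t) - d t = fst ?u' - xh"
    by (simp add: d_def xh_def scaleR_2)
  then have bil: "(snd w - snd ?u') \<bullet> (A *v (d (Suc t) - d t)) = snd w \<bullet> (A *v fst ?u')
      - snd w \<bullet> (A *v xh) - snd ?u' \<bullet> (A *v fst ?u') + snd ?u' \<bullet> (A *v xh)"
    by (simp add: matrix_vector_mult_diff_distrib inner_diff_left inner_diff_right)
  show ?thesis
    using iter_Suc_optimality(2)[OF w, of v t, folded xh_def] iter_Suc_optimality(3)[OF w, of v t]
    unfolding saddle_gap_def saddle_function_def bil sq
      times_divide_eq_left mult_1 add_divide_distrib diff_divide_distrib by linarith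
qed

text \<open>The bilinear terms telescope up to
  \<open>(snd ?u' - snd ?u) \<bullet> (A *v d t)\<close>. The term
  \<open>- (norm (d t))\<^sup>2\<close> is carried in the bound to absorb this remainder, together
  with the dual part of the step length; the primal part renews it.\<close>

lemma sum_gap_iter_le:
  fixes v
  assumes w: "w \<in> X \<times> Y"
  defines "d \<equiv> \<lambda>t. fst (iter v t) - fst (iter v (t - 1))"
  shows "(\<Sum>k=1..t. gap w (iter v k)) \<le> (snd w - snd (iter v t)) \<bullet> (A *v d t)
    + ((norm (w - v))\<^sup>2 - (norm (w - iter v t))\<^sup>2 - (norm (d t))\<^sup>2) / (2 * \<gamma>)"
proof (induction t)
  case 0
  \<comment> \<open>\<open>d 0 = 0\<close> by truncated subtraction.\<close>
  show ?case by (simp add: d_def iter_0)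
next
  case (Suc t)
  let ?u = "iter v t" and ?u' = "iter v (Suc t)"
  have "(\<gamma> * spectral_norm A)\<^sup>2 \<le> 1"
    using \<gamma>_pos \<gamma>_less spectral_norm_nonneg[of A] by (simp add: power_le_one)
  then have "((\<gamma> * spectral_norm A)\<^sup>2 * (norm (snd ?u' - snd ?u))\<^sup>2 + (norm (d t))\<^sup>2) / (2 * \<gamma>)
      \<le> ((norm (snd ?u' - snd ?u))\<^sup>2 + (norm (d t))\<^sup>2) / (2 * \<gamma>)"
    using \<gamma>_pos by (intro divide_right_mono add_mono mult_left_le_one_le) auto
  with inner_matrix_vector_le_squares[of "snd ?u' - snd ?u" "d t"]
  have cross: "(snd ?u' - snd ?u) \<bullet> (A *v d t) \<le> ((norm (snd ?u' - snd ?u))\<^sup>2 + (norm (d t))\<^sup>2) / (2 * \<gamma>)"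
    by (rule order_trans)
  have split: "(norm (?u' - ?u))\<^sup>2 = (norm (d (Suc t)))\<^sup>2 + (norm (snd ?u' - snd ?u))\<^sup>2"
    by (simp add: norm_prod_def d_def)
  have bil: "(snd w - snd ?u') \<bullet> (A *v (d (Suc t) - d t)) + (snd w - snd ?u) \<bullet> (A *v d t)
      = (snd w - snd ?u') \<bullet> (A *v d (Suc t)) + (snd ?u' - snd ?u) \<bullet> (A *v d t)"
    by (simp add: matrix_vector_mult_diff_distrib inner_diff_left inner_diff_right)
  have step: "gap w ?u' \<le> (snd w - snd ?u') \<bullet> (A *v (d (Suc t) - d t))
    + ((norm (w - ?u))\<^sup>2 - (norm (?u' - ?u))\<^sup>2 - (norm (w - ?u'))\<^sup>2) / (2 * \<gamma>)"
    unfolding d_def by (rule gap_iter_Suc_le[OF w])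
  have "(\<Sum>k=1..Suc t. gap w (iter v k)) = (\<Sum>k=1..t. gap w (iter v k)) + gap w ?u'"
    by simp
  then show ?case
    using Suc step cross bil
    unfolding split add_divide_distrib diff_divide_distrib by linarith
qed

text \<open>The boundary bilinear term is absorbed by the retained square of \<open>d\<close> and a
  fraction \<open>(\<gamma> * spectral_norm A)\<^sup>2\<close> of the squared distance to the last
  iterate.\<close>

lemma sum_gap_iter_le_distance:
  assumes w: "w \<in> X \<times> Y"
  shows "(\<Sum>k=1..t. gap w (iter v k))
    \<le> ((norm (w - v))\<^sup>2 - (1 - (\<gamma> * spectral_norm A)\<^sup>2) * (norm (w - iter v t))\<^sup>2) / (2 * \<gamma>)"
proof -
  define d where "d = fst (iter v t) - fst (iter v (t - 1))"
  have "snd (w - iter v t) \<bullet> (A *v d) \<le> ((\<gamma> * spectral_norm A)\<^sup>2 * (norm (snd (w - iter v t)))\<^sup>2 + (norm d)\<^sup>2) / (2 * \<gamma>)"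
    by (rule inner_matrix_vector_le_squares)
  also have "\<dots> \<le> ((\<gamma> * spectral_norm A)\<^sup>2 * (norm (w - iter v t))\<^sup>2 + (norm d)\<^sup>2) / (2 * \<gamma>)"
  proof -
    have "norm (snd (w - iter v t)) \<le> norm (w - iter v t)"
      by (metis norm_snd_le prod.collapse)
    then show ?thesis
      using \<gamma>_pos by (intro divide_right_mono add_mono mult_left_mono power_mono order_refl) auto
  qed
  finally show ?thesis
    using sum_gap_iter_le[OF w, of v t, folded d_def]
    by (simp add: add_divide_distrib diff_divide_distrib algebra_simps)
qed

section \<open>Bounds on the average iterate\<close>

lemma contraction_pos: "0 < 1 - (\<gamma> * spectral_norm A)\<^sup>2"
  using \<gamma>_pos \<gamma>_less spectral_norm_nonneg[of A] by (simp add: power_less_one_iff)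

lemma avg_in: "v \<in> X \<times> Y \<Longrightarrow> 1 \<le> t \<Longrightarrow> avg v t \<in> X \<times> Y"
  unfolding pdhg_average_def by (intro convex_on_average(1)[OF convex_on_gap] iter_in)

text \<open>Jensen's inequality for the averaged argument, dropping the negative distance
  term.\<close>

lemma gap_avg_le:
  assumes "v \<in> X \<times> Y" "1 \<le> t" and w: "w \<in> X \<times> Y"
  shows "gap w (avg v t) \<le> (norm (w - v))\<^sup>2 / (2 * \<gamma> * real t)"
proof -
  have "gap w (avg v t) \<le> (\<Sum>k=1..t. gap w (iter v k)) / real t"
    unfolding pdhg_average_def using assms by (intro convex_on_average(2)[OF convex_on_gap] iter_in)
  also have "\<dots> \<le> ((norm (w - v))\<^sup>2 / (2 * \<gamma>)) / real t"
  proof (intro divide_right_mono)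
    have "((norm (w - v))\<^sup>2 - (1 - (\<gamma> * spectral_norm A)\<^sup>2) * (norm (w - iter v t))\<^sup>2) / (2 * \<gamma>)
        \<le> (norm (w - v))\<^sup>2 / (2 * \<gamma>)"
      using \<gamma>_pos contraction_pos by (intro divide_right_mono) auto
    then show "(\<Sum>k=1..t. gap w (iter v k)) \<le> (norm (w - v))\<^sup>2 / (2 * \<gamma>)"
      using sum_gap_iter_le_distance[OF w, of v t] by linarith
  qed auto
  finally show ?thesis by simp
qed

text \<open>Against an optimal point all gaps are nonnegative, so the telescoped bound becomes a
  bound on the distance.\<close>

lemma norm_optimal_minus_iter_le:
  assumes "v \<in> X \<times> Y" and w: "w \<in> optimal_set (X \<times> Y) (saddle_function A G Fs)"
  shows "norm (w - iter v t) \<le> (1 - (\<gamma> * spectral_norm A)\<^sup>2) powr (- 1 / 2) * norm (w - v)"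
proof -
  define c where "c = 1 - (\<gamma> * spectral_norm A)\<^sup>2"
  have c: "0 < c" using contraction_pos by (simp add: c_def)
  have wW: "w \<in> X \<times> Y" using w by (simp add: optimal_set_def)
  have "0 \<le> (\<Sum>k=1..t. gap w (iter v k))"
    using assms by (intro sum_nonneg gap_optimal_nonneg iter_in)
  also have "\<dots> \<le> ((norm (w - v))\<^sup>2 - c * (norm (w - iter v t))\<^sup>2) / (2 * \<gamma>)"
    unfolding c_def by (rule sum_gap_iter_le_distance[OF wW])
  finally have "c * (norm (w - iter v t))\<^sup>2 \<le> (norm (w - v))\<^sup>2"
    using \<gamma>_pos by (simp add: zero_le_divide_iff)
  then have "(norm (w - iter v t))\<^sup>2 \<le> (norm (w - v) / sqrt c)\<^sup>2"
    using c by (simp add: power_divide field_simps)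
  then have "norm (w - iter v t) \<le> norm (w - v) / sqrt c"
    by (rule power2_le_imp_le) (use c in auto)
  also have "\<dots> = c powr (- 1 / 2) * norm (w - v)"
    using c powr_minus_divide[of c "1 / 2"] by (simp add: powr_half_sqrt)
  finally show ?thesis by (simp add: c_def)
qed

lemma norm_avg_minus_start_le:
  fixes v
  defines "Ws \<equiv> optimal_set (X \<times> Y) (saddle_function A G Fs)"
  assumes v: "v \<in> X \<times> Y" and t: "1 \<le> t" and "Ws \<noteq> {}"
  shows "norm (avg v t - v) \<le> (1 + (1 - (\<gamma> * spectral_norm A)\<^sup>2) powr (- 1 / 2)) * infdist v Ws"
proof -
  define q where "q = (1 - (\<gamma> * spectral_norm A)\<^sup>2) powr (- 1 / 2)"
  have q: "0 \<le> q" by (simp add: q_def)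
  \<comment> \<open>Dividing by \<open>1 + q\<close> first makes the left side a lower bound of all
    distances to \<open>Ws\<close>, hence of their infimum.\<close>
  have "norm (avg v t - v) / (1 + q) \<le> dist v w" if w: "w \<in> Ws" for w
  proof -
    have "avg v t - v = (1 / real t) *\<^sub>R (\<Sum>k=1..t. iter v k - v)"
    proof -
      have "(\<Sum>k=1..t. iter v k - v) = (\<Sum>k=1..t. iter v k) - real t *\<^sub>R v"
        by (simp add: sum_subtractf sum_constant_scaleR)
      then show ?thesis using t by (simp add: pdhg_average_def scaleR_diff_right)
    qed
    also have "norm \<dots> \<le> (1 / real t) * (\<Sum>k=1..t. (1 + q) * dist v w)"
    proof -
      have "norm (iter v k - v) \<le> (1 + q) * dist v w" for k
      proof -
        have "norm (iter v k - v) \<le> norm (w - iter v k) + norm (w - v)"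
          using norm_triangle_ineq4[of "w - v" "w - iter v k"] by simp
        also have "\<dots> \<le> q * norm (w - v) + norm (w - v)"
          using norm_optimal_minus_iter_le[OF v, of w k] w by (simp add: q_def Ws_def)
        finally show ?thesis by (simp add: dist_norm norm_minus_commute algebra_simps)
      qed
      then have "norm (\<Sum>k=1..t. iter v k - v) \<le> (\<Sum>k=1..t. (1 + q) * dist v w)"
        by (intro sum_norm_le) auto
      then show ?thesis unfolding norm_scaleR by (intro mult_mono) auto
    qed
    also have "\<dots> = (1 + q) * dist v w" using t by simp
    finally show ?thesis using q by (simp add: divide_le_eq mult.commute)
  qed
  then have "norm (avg v t - v) / (1 + q) \<le> infdist v Ws"
    unfolding infdist_notempty[OF \<open>Ws \<noteq> {}\<close>] using \<open>Ws \<noteq> {}\<close> by (intro cINF_greatest)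
  then have "norm (avg v t - v) \<le> (1 + q) * infdist v Ws"
    using q by (simp add: divide_le_eq mult.commute)
  then show ?thesis by (simp only: q_def)
qed

text \<open>Since \<open>u \<mapsto> gap u w\<close> is concave and vanishes at \<open>w\<close>, the localized gap per unit radius is
  nonincreasing in the radius, so that it may be estimated at any radius \<open>\<alpha> \<le> r\<close>.\<close>

lemma localized_gap_avg_le:
  assumes v: "v \<in> X \<times> Y" and t: "1 \<le> t" and \<alpha>: "0 < \<alpha>" "\<alpha> \<le> r"
  shows "\<alpha> * localized_duality_gap (X \<times> Y) (saddle_function A G Fs) r (avg v t)
    \<le> r * ((\<alpha> + norm (avg v t - v))\<^sup>2 / (2 * \<gamma> * real t))"
proof -
  define w where "w = avg v t"
  define b where "b = (\<alpha> + norm (w - v))\<^sup>2 / (2 * \<gamma> * real t)"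
  have w: "w \<in> X \<times> Y" unfolding w_def by (rule avg_in[OF v t])
  have r: "0 < r" using \<alpha> by simp
  have "- gap w u \<le> r * b / \<alpha>" if u: "u \<in> X \<times> Y" "dist w u \<le> r" for u
  proof -
    \<comment> \<open>Contracting \<open>u\<close> towards \<open>w\<close> by
      \<open>\<alpha> / r\<close> brings it within \<open>\<alpha>\<close> of
      \<open>w\<close>.\<close>
    define p where "p = (1 - \<alpha> / r) *\<^sub>R w + (\<alpha> / r) *\<^sub>R u"
    have p: "p \<in> X \<times> Y"
      unfolding p_def using \<alpha> r u w convex_Times[OF convex_X convex_Y] by (intro convexD_alt) auto
    have "gap w p \<le> (1 - \<alpha> / r) * gap w w + (\<alpha> / r) * gap w u"
      unfolding p_def using \<alpha> r u w by (intro convex_onD[OF convex_on_gap]) auto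
    then have "(\<alpha> / r) * (- gap w u) \<le> gap p w"
      by (simp add: saddle_gap_self saddle_gap_swap[of A G Fs p w])
    also have "\<dots> \<le> (norm (p - v))\<^sup>2 / (2 * \<gamma> * real t)"
      unfolding w_def by (rule gap_avg_le[OF v t p])
    also have "\<dots> \<le> b"
    proof -
      have "p - w = (\<alpha> / r) *\<^sub>R (u - w)" by (simp add: p_def algebra_simps)
      then have "norm (p - w) = \<alpha> / r * dist w u" using \<alpha> r by (simp add: dist_norm norm_minus_commute)
      also have "\<dots> \<le> \<alpha>" using \<alpha> r u by (simp add: divide_le_eq mult_left_mono)
      finally have "norm (p - v) \<le> \<alpha> + norm (w - v)"
        using norm_triangle_ineq[of "p - w" "w - v"] by simp
      then show ?thesis unfolding b_def using \<gamma>_pos by (intro divide_right_mono power_mono) auto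
    qed
    finally show ?thesis using \<alpha> r by (simp add: field_simps)
  qed
  then have "localized_duality_gap (X \<times> Y) (saddle_function A G Fs) r w \<le> r * b / \<alpha>"
    unfolding localized_duality_gap_def saddle_gap_def using w r by (intro cSUP_least) auto
  then have "\<alpha> * localized_duality_gap (X \<times> Y) (saddle_function A G Fs) r w \<le> r * b"
    using \<alpha> by (simp add: pos_le_divide_eq mult.commute)
  then show ?thesis by (simp add: w_def b_def)
qed

text \<open>Sharpness bounds the localized gap from below, \<open>localized_gap_avg_le\<close> from
  above; one factor \<open>r\<close> cancels. This supplies the hypothesis of
  \<open>distance_le_rate\<close> with \<open>\<kappa> = 2 * \<gamma> * \<theta>\<close>.\<close>

lemma sharp_avg_ineq:
  fixes v t
  defines "Ws \<equiv> optimal_set (X \<times> Y) (saddle_function A G Fs)"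
  defines "r \<equiv> infdist (avg v t) Ws"
  assumes v: "v \<in> X \<times> Y" and t: "1 \<le> t" and \<alpha>: "0 < \<alpha>" "\<alpha> \<le> r"
    and sharp: "\<theta> * r\<^sup>2 \<le> localized_duality_gap (X \<times> Y) (saddle_function A G Fs) r (avg v t)"
  shows "\<alpha> * (2 * \<gamma> * \<theta>) * real t * r \<le> (\<alpha> + norm (avg v t - v))\<^sup>2"
proof -
  let ?b = "(\<alpha> + norm (avg v t - v))\<^sup>2"
  have pos: "0 < 2 * \<gamma> * real t" using \<gamma>_pos t by simp
  have "r * (\<alpha> * \<theta> * r) = \<alpha> * (\<theta> * r\<^sup>2)" by (simp add: power2_eq_square)
  also have "\<dots> \<le> \<alpha> * localized_duality_gap (X \<times> Y) (saddle_function A G Fs) r (avg v t)"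
    using sharp \<alpha> by (intro mult_left_mono) auto
  also have "\<dots> \<le> r * (?b / (2 * \<gamma> * real t))"
    by (rule localized_gap_avg_le[OF v t \<alpha>])
  finally have "\<alpha> * \<theta> * r \<le> ?b / (2 * \<gamma> * real t)" using \<alpha>
    by (elim mult_left_le_imp_le) auto
  then have "\<alpha> * \<theta> * r * (2 * \<gamma> * real t) \<le> ?b"
    using pos by (simp only: pos_le_divide_eq)
  then show ?thesis by (simp add: ac_simps)
qed

end

section \<open>Restarts\<close>

theorem theorem2:
  fixes X :: "(real ^ 'p) set" and Y :: "(real ^ 'm) set"
    and A :: "real ^ 'p ^ 'm"
    and G :: "real ^ 'p \<Rightarrow> real" and Fs :: "real ^ 'm \<Rightarrow> real"
    and F :: "real ^ 'm \<Rightarrow> real" and D :: "(real ^ 'm) set"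
    and \<theta> \<gamma> \<beta> \<epsilon> L q tstar :: real
    and W Wstar :: "((real ^ 'p) \<times> (real ^ 'm)) set"
    and f :: "real ^ 'p \<Rightarrow> real ^ 'm \<Rightarrow> real"
    and v :: "nat \<Rightarrow> (real ^ 'p) \<times> (real ^ 'm)" and \<tau> :: "nat \<Rightarrow> nat" and n :: nat
  defines "W \<equiv> X \<times> Y"
    and "f \<equiv> saddle_function A G Fs"
    and "Wstar \<equiv> optimal_set W f"
    and "L \<equiv> spectral_norm A"
    and "q \<equiv> (1 - \<gamma>\<^sup>2 * L\<^sup>2) powr (- 1 / 2)"
    and "tstar \<equiv> (1 + q)\<^sup>2 * (1 + \<beta>)\<^sup>2 / \<beta>\<^sup>2 * (1 / (2 * \<gamma> * \<theta>)) + 2"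
    and "n \<equiv> nat \<lceil>log (1 / \<beta>) ((1 + q) / \<epsilon> * max 1 (tstar / real (\<tau> 1)))\<rceil>"
  assumes "closed X" and "convex X" and "closed Y" and "convex Y"
    and "continuous_on X G" and "convex_on X G"
    and "continuous_on Y Fs" and "convex_on Y Fs"
    and "convex D" and "continuous_on D F" and "convex_on D F"
    and "\<forall>y\<in>Y. ereal (Fs y) = convex_conjugate D F y"
    and "0 < \<theta>" and "\<theta> \<le> L"
    and "0 < \<gamma>" and "\<gamma> < 1 / L"
    and "0 < \<beta>" and "\<beta> < 1"
    and "0 < \<epsilon>" and "\<epsilon> < 1"
    and "Wstar \<noteq> {}"
    and "\<forall>w\<in>W. \<theta> * (infdist w Wstar)\<^sup>2 \<le> localized_duality_gap W f (infdist w Wstar) w"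
    and "adaptively_restarted_pdhg X Y A G Fs \<gamma> \<beta> v \<tau>"
  shows "(\<forall>i>1. \<exists>t\<ge>1. restart_condition X Y A G Fs \<gamma> \<beta> v \<tau> i t)
    \<and> infdist (v n) Wstar \<le> \<epsilon> * infdist (v 0) Wstar
    \<and> (\<Sum>i=1..n. real (\<tau> i)) \<le> tstar * real n + 2 * max (real (\<tau> 1) - tstar) 0"
proof -
  note fs = assms(8-30)
  have closed: "closed X" "closed Y" and cont: "continuous_on X G" "continuous_on Y Fs"
    and conv: "convex_on X G" "convex_on Y Fs"
    and \<theta>: "0 < \<theta>" "\<theta> \<le> L" and \<gamma>: "0 < \<gamma>" "\<gamma> < 1 / L" and \<beta>: "0 < \<beta>" "\<beta> < 1"
    and \<epsilon>: "0 < \<epsilon>" "\<epsilon> < 1" and Wstar: "Wstar \<noteq> {}"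
    and sharp: "\<And>w. w \<in> W \<Longrightarrow> \<theta> * (infdist w Wstar)\<^sup>2 \<le> localized_duality_gap W f (infdist w Wstar) w"
    and restarts: "adaptively_restarted_pdhg X Y A G Fs \<gamma> \<beta> v \<tau>"
    using fs by blast+
  have \<gamma>L: "\<gamma> * L < 1" using \<gamma> \<theta> by (simp add: pos_less_divide_eq)
  interpret pdhg X Y A G Fs \<gamma>
    using closed cont conv \<gamma> \<gamma>L by unfold_locales (simp_all add: L_def)
  have q_eq: "q = (1 - (\<gamma> * spectral_norm A)\<^sup>2) powr (- 1 / 2)"
    by (simp add: q_def L_def power_mult_distrib)
  have q1: "1 \<le> q"
  proof -
    have "(1::real) powr (- 1 / 2) \<le> q"
      unfolding q_eq using contraction_pos by (intro powr_mono2') auto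
    then show ?thesis by simp
  qed

  have v0: "v 0 \<in> W" and \<tau>1: "1 \<le> \<tau> 1"
    and v_Suc: "\<And>i. v (Suc i) = avg (v i) (\<tau> (Suc i))"
    and \<tau>_least: "\<And>i. 1 < i \<Longrightarrow> \<tau> i = (LEAST t. 1 \<le> t \<and> restart_condition X Y A G Fs \<gamma> \<beta> v \<tau> i t)"
    using restarts by (auto simp: adaptively_restarted_pdhg_def W_def)

  \<comment> \<open>Constants of the restart scheme\<close>
  define \<kappa> where "\<kappa> = 2 * \<gamma> * \<theta>"
  \<comment> \<open>An epoch moves at most \<open>(1 + q) * r i\<close>; dividing by the
    \<open>\<beta>\<close> of the restart condition gives \<open>a\<close>.\<close>
  define a where "a = (1 + q) / \<beta>"
  \<comment> \<open>\<open>B t\<close> is an epoch length sufficient for a restart when the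
    preceding epoch took \<open>t\<close> steps.\<close>
  define B where "B t = tstar - 1 + max (t - tstar) 0 / 2" for t :: real
  define r where "r i = infdist (v i) Wstar" for i
  define s where "s i = norm (v (Suc i) - v i)" for i
  have r_nonneg: "0 \<le> r i" and s_nonneg: "0 \<le> s i" for i
    by (auto simp: r_def s_def infdist_nonneg)
  have \<kappa>: "0 < \<kappa>" using \<theta> \<gamma> by (simp add: \<kappa>_def)
  have tstar: "tstar = a\<^sup>2 * (1 + \<beta>)\<^sup>2 / \<kappa> + 2"
    by (simp add: tstar_def a_def \<kappa>_def power_divide)
  then have tstar2: "2 \<le> tstar" using \<kappa> by simp
  then have B1: "1 \<le> B t" for t by (simp add: B_def add_increasing2)
  have a\<beta>: "a * \<beta> = 1 + q" using \<beta> by (simp add: a_def)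
  have a2: "2 \<le> a" using \<beta> q1 by (simp add: a_def le_divide_eq)
  have a4: "4 \<le> a * (1 + \<beta>)\<^sup>2"
  proof -
    have "a * (1 + \<beta>)\<^sup>2 = a + 2 * (a * \<beta>) + a * \<beta>\<^sup>2" by (simp add: power2_eq_square algebra_simps)
    moreover have "0 \<le> a * \<beta>\<^sup>2" using a2 by simp
    ultimately show ?thesis using a2 a\<beta> q1 by linarith
  qed

  \<comment> \<open>Epoch lengths\<close>
  have s_le: "norm (avg (v i) t - v i) \<le> (1 + q) * r i" if "v i \<in> W" "1 \<le> t" for i t
    using norm_avg_minus_start_le[of "v i" t] that Wstar
    by (simp add: q_eq r_def Wstar_def W_def f_def)
  have rate: "a * r (Suc i) * real (\<tau> (Suc i)) \<le> B (real (\<tau> (Suc i))) * s i"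
    if i: "v i \<in> W" "1 \<le> \<tau> (Suc i)" for i
    unfolding B_def
  proof (rule distance_le_rate)
    show "\<alpha> * \<kappa> * real (\<tau> (Suc i)) * r (Suc i) \<le> (\<alpha> + s i)\<^sup>2" if "0 < \<alpha>" "\<alpha> \<le> r (Suc i)" for \<alpha>
      using sharp_avg_ineq[of "v i" "\<tau> (Suc i)" \<alpha> \<theta>] sharp[of "v (Suc i)"] avg_in[of "v i" "\<tau> (Suc i)"] i that
      by (simp add: v_Suc r_def s_def \<kappa>_def Wstar_def W_def f_def)
    show "tstar = a\<^sup>2 * (1 + \<beta>)\<^sup>2 / \<kappa> + 2" by (rule tstar)
  qed (use \<kappa> \<beta> a2 a4 a\<beta> q1 i r_nonneg s_nonneg in auto)

  have condition_iff: "restart_condition X Y A G Fs \<gamma> \<beta> v \<tau> (Suc (Suc i)) t \<longleftrightarrow>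
      norm (avg (v (Suc i)) t - v (Suc i)) / real t \<le> \<beta> * (s i / real (\<tau> (Suc i)))" for i t
    by (simp add: restart_condition_def s_def)
  \<comment> \<open>The displacement is at most \<open>\<beta> * (a * r (Suc i))\<close>, and
    \<open>rate\<close> bounds \<open>a * r (Suc i)\<close> by \<open>B\<close> times the preceding
    displacement per step.\<close>
  have condition: "restart_condition X Y A G Fs \<gamma> \<beta> v \<tau> (Suc (Suc i)) t"
    if i: "v i \<in> W" "1 \<le> \<tau> (Suc i)" and t: "B (real (\<tau> (Suc i))) \<le> real t" for i t
  proof -
    have t1: "1 \<le> t" using B1[of "real (\<tau> (Suc i))"] t by linarith
    have "v (Suc i) \<in> W" using avg_in[of "v i"] i by (simp add: v_Suc W_def)
    then have "norm (avg (v (Suc i)) t - v (Suc i)) \<le> \<beta> * (a * r (Suc i))"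
      using s_le[OF _ t1, of "Suc i"] a\<beta> by (simp add: mult.assoc[symmetric] mult.commute)
    also have "a * r (Suc i) \<le> B (real (\<tau> (Suc i))) * s i / real (\<tau> (Suc i))"
      using rate[OF i] i by (simp add: pos_le_divide_eq)
    also have "B (real (\<tau> (Suc i))) * s i / real (\<tau> (Suc i)) \<le> real t * s i / real (\<tau> (Suc i))"
      using t s_nonneg by (intro divide_right_mono mult_right_mono) auto
    finally have "norm (avg (v (Suc i)) t - v (Suc i)) \<le> \<beta> * (s i / real (\<tau> (Suc i))) * real t"
      using \<beta> by (simp add: ac_simps)
    then show ?thesis unfolding condition_iff using t1 by (simp add: pos_divide_le_eq)
  qed

  have step: "restart_condition X Y A G Fs \<gamma> \<beta> v \<tau> (Suc (Suc i)) (\<tau> (Suc (Suc i)))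
      \<and> 1 \<le> \<tau> (Suc (Suc i)) \<and> real (\<tau> (Suc (Suc i))) \<le> B (real (\<tau> (Suc i))) + 1"
    if i: "v i \<in> W" "1 \<le> \<tau> (Suc i)" for i
  proof -
    \<comment> \<open>Rounding \<open>B\<close> up gives a witness, so \<open>LEAST\<close> is
      meaningful and exceeds \<open>B\<close> by at most 1.\<close>
    define t where "t = nat \<lceil>B (real (\<tau> (Suc i)))\<rceil>"
    have t: "B (real (\<tau> (Suc i))) \<le> real t" "real t \<le> B (real (\<tau> (Suc i))) + 1"
      unfolding t_def using B1[of "real (\<tau> (Suc i))"] by linarith+
    let ?P = "\<lambda>t. 1 \<le> t \<and> restart_condition X Y A G Fs \<gamma> \<beta> v \<tau> (Suc (Suc i)) t"
    have "1 \<le> t" using B1[of "real (\<tau> (Suc i))"] t by linarith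
    then have P: "?P t" using condition[OF i t(1)] by simp
    have "?P (\<tau> (Suc (Suc i)))" and "\<tau> (Suc (Suc i)) \<le> t"
      using LeastI[of ?P, OF P] Least_le[of ?P, OF P] \<tau>_least[of "Suc (Suc i)"] by simp_all
    then show ?thesis using t by linarith
  qed

  \<comment> \<open>Both facts are carried together because \<open>step\<close> needs both at the
    preceding epoch.\<close>
  have good: "v i \<in> W \<and> 1 \<le> \<tau> (Suc i)" for i
  proof (induction i)
    case 0
    show ?case using v0 \<tau>1 by simp
  next
    case (Suc i)
    then show ?case using step[of i] avg_in[of "v i" "\<tau> (Suc i)"] by (simp add: v_Suc W_def)
  qed
  \<comment> \<open>The \<open>- 1\<close> in \<open>B\<close> cancels the rounding error.\<close>
  have length_step: "real (\<tau> (Suc (Suc i))) \<le> tstar + max (real (\<tau> (Suc i)) - tstar) 0 / 2" for i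
    using step[of i] good[of i] by (simp add: B_def)

  \<comment> \<open>Total number of steps\<close>
  define E where "E = max (real (\<tau> 1) - tstar) 0"
  have E0: "0 \<le> E" by (simp add: E_def)
  have excess: "max (real (\<tau> (Suc k)) - tstar) 0 \<le> E / 2 ^ k" for k
  proof (induction k)
    case 0
    show ?case by (simp add: E_def)
  next
    case (Suc k)
    have "max (real (\<tau> (Suc k)) - tstar) 0 / 2 \<le> E / 2 ^ Suc k"
      using Suc by simp
    then have "real (\<tau> (Suc (Suc k))) - tstar \<le> E / 2 ^ Suc k"
      using length_step[of k] by linarith
    moreover have "0 \<le> E / 2 ^ Suc k" using E0 by simp
    ultimately show ?case by (rule max.boundedI)
  qed
  \<comment> \<open>Summing the halving excesses gives \<open>2 * E\<close>; the exact geometric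
    remainder is kept so that the induction closes.\<close>
  have total: "(\<Sum>i=1..m. real (\<tau> i)) \<le> tstar * real m + (2 * E - 2 * E / 2 ^ m)" for m
  proof (induction m)
    case (Suc m)
    have "real (\<tau> (Suc m)) - tstar \<le> E / 2 ^ m"
      using excess[of m] by simp
    moreover have "2 * E / 2 ^ m = 2 * (E / 2 ^ m)" "2 * E / 2 ^ Suc m = E / 2 ^ m" by simp_all
    moreover have "tstar * real (Suc m) = tstar * real m + tstar" by (simp add: algebra_simps)
    moreover have "(\<Sum>i=1..Suc m. real (\<tau> i)) = (\<Sum>i=1..m. real (\<tau> i)) + real (\<tau> (Suc m))" by simp
    ultimately show ?case using Suc by linarith
  qed simp

  \<comment> \<open>Decay of the distance\<close>
  have displacement: "s k / real (\<tau> (Suc k)) \<le> \<beta> ^ k * ((1 + q) * r 0 / real (\<tau> 1))" for k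
  proof (induction k)
    case 0
    have "s 0 \<le> (1 + q) * r 0" using s_le[of 0 "\<tau> 1"] v0 \<tau>1 by (simp add: s_def v_Suc)
    then show ?case by (simp add: divide_right_mono)
  next
    case (Suc k)
    \<comment> \<open>The stopping rule itself contributes one factor \<open>\<beta>\<close> per
      epoch.\<close>
    have "s (Suc k) / real (\<tau> (Suc (Suc k))) \<le> \<beta> * (s k / real (\<tau> (Suc k)))"
      using step[of k] good[of k] unfolding condition_iff by (simp add: s_def v_Suc[of "Suc k"])
    also have "\<dots> \<le> \<beta> * (\<beta> ^ k * ((1 + q) * r 0 / real (\<tau> 1)))"
      using Suc \<beta> by (intro mult_left_mono) auto
    finally show ?case by (simp add: mult.assoc)
  qed

  define M where "M = max 1 (tstar / real (\<tau> 1))"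
  have M1: "1 \<le> M" by (simp add: M_def)
  have distance: "r (Suc k) \<le> M * \<beta> ^ Suc k * r 0" for k
  proof -
    \<comment> \<open>\<open>M * real (\<tau> 1)\<close> is the larger of \<open>tstar\<close> and
      the first length, that is \<open>tstar + E\<close>, which dominates \<open>B\<close> at every
      epoch length.\<close>
    have BM: "B (real (\<tau> (Suc k))) \<le> M * real (\<tau> 1)"
    proof -
      define e where "e = max (real (\<tau> (Suc k)) - tstar) 0"
      have "E / 2 ^ k \<le> E / 1" using E0 by (intro divide_left_mono) auto
      then have "e \<le> E" using excess[of k] by (simp add: e_def)
      moreover have "B (real (\<tau> (Suc k))) = tstar - 1 + e / 2" by (simp add: B_def e_def)
      ultimately have "B (real (\<tau> (Suc k))) \<le> tstar + E" using E0 by linarith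
      also have "\<dots> = M * real (\<tau> 1)" using \<tau>1 by (auto simp: E_def M_def max_def field_simps)
      finally show ?thesis .
    qed
    have "a * r (Suc k) \<le> B (real (\<tau> (Suc k))) * (s k / real (\<tau> (Suc k)))"
      using rate[of k] good[of k] by (simp add: pos_le_divide_eq)
    also have "\<dots> \<le> (M * real (\<tau> 1)) * (\<beta> ^ k * ((1 + q) * r 0 / real (\<tau> 1)))"
      using BM displacement[of k] B1[of "real (\<tau> (Suc k))"] s_nonneg M1 by (intro mult_mono) auto
    also have "\<dots> = (1 + q) * (M * \<beta> ^ k * r 0)" using \<tau>1 by simp
    \<comment> \<open>Since \<open>a * \<beta> = 1 + q\<close>, this multiplication yields the last
      power of \<open>\<beta>\<close> and lets \<open>1 + q\<close> cancel.\<close>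
    finally have "\<beta> * (a * r (Suc k)) \<le> \<beta> * ((1 + q) * (M * \<beta> ^ k * r 0))"
      using \<beta> by (intro mult_left_mono) auto
    then have "(1 + q) * r (Suc k) \<le> (1 + q) * (M * \<beta> ^ Suc k * r 0)"
      by (simp add: a\<beta>[symmetric] ac_simps)
    then show ?thesis using q1 by simp
  qed

  \<comment> \<open>The choice of \<open>n\<close>\<close>
  define x where "x = (1 + q) / \<epsilon> * M"
  \<comment> \<open>\<open>x > 1\<close> forces \<open>n\<close> to be positive, as
    \<open>distance\<close> speaks of indices \<open>Suc k\<close> only.\<close>
  have "1 * 1 < (1 + q) / \<epsilon> * M"
    using q1 \<epsilon> M1 by (intro mult_less_le_imp_less) (auto simp: less_divide_eq)
  then have x1: "1 < x" by (simp add: x_def)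
  have n: "n = nat \<lceil>log (1 / \<beta>) x\<rceil>" by (simp add: n_def x_def M_def)
  have b1: "1 < 1 / \<beta>" using \<beta> by simp
  have "0 < log (1 / \<beta>) x" using b1 x1 by simp
  then have "0 < n" by (simp add: n)
  then obtain k where k: "n = Suc k" by (cases n) auto
  have "x \<le> (1 / \<beta>) ^ n"
  proof -
    have "x = (1 / \<beta>) powr log (1 / \<beta>) x" using b1 x1 \<beta> by (subst powr_log_cancel) auto
    also have "\<dots> \<le> (1 / \<beta>) powr real n"
      using b1 by (intro powr_mono) (auto simp: n real_nat_ceiling_ge)
    also have "\<dots> = (1 / \<beta>) ^ n" using \<beta> by (simp add: powr_realpow)
    finally show ?thesis .
  qed
  then have "x * \<beta> ^ n \<le> 1" using \<beta> by (simp add: power_divide pos_le_divide_eq)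
  then have "(1 + q) * (M * \<beta> ^ n) \<le> \<epsilon>" using \<epsilon> by (simp add: x_def field_simps)
  moreover have "1 * (M * \<beta> ^ n) \<le> (1 + q) * (M * \<beta> ^ n)"
    using q1 M1 \<beta> by (intro mult_right_mono) auto
  ultimately have "M * \<beta> ^ n \<le> \<epsilon>" by linarith
  then have "M * \<beta> ^ n * r 0 \<le> \<epsilon> * r 0" using r_nonneg by (intro mult_right_mono)
  then have "infdist (v n) Wstar \<le> \<epsilon> * infdist (v 0) Wstar"
    using distance[of k] by (simp add: k r_def)
  moreover have "(\<Sum>i=1..n. real (\<tau> i)) \<le> tstar * real n + 2 * max (real (\<tau> 1) - tstar) 0"
  proof -
    have "0 \<le> 2 * E / 2 ^ n" using E0 by simp
    then show ?thesis using total[of n] unfolding E_def by linarith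
  qed
  moreover have "\<exists>t\<ge>1. restart_condition X Y A G Fs \<gamma> \<beta> v \<tau> i t" if "1 < i" for i
  proof -
    obtain j where j: "i = Suc (Suc j)" using less_imp_Suc_add[OF \<open>1 < i\<close>] by auto
    show ?thesis using step[of j] good[of j] unfolding j by blast
  qed
  ultimately show ?thesis by blast
qed

end
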